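(* Let $K\subset(\mathbb{R}^{2},\omega_0)$ be a convex body. Then $$c_{\rm EHZ}(K\times_L J_2K)\leqslant 2\,{\rm Vol}(K),$$ where ${\rm Vol}(K)$ denotes the Euclidean volume (area) of $K$, and the capacity is taken in $\mathbb{R}^{2}_q\times\mathbb{R}^{2}_p=\mathbb{R}^{4}$ with its standard symplectic form.
   Context: Convex body: compact convex set with non-empty interior. Symplectic form and complex structure: for $m\ge1$, $\mathbb{R}^{2m}=\mathbb{R}^m_q\times\mathbb{R}^m_p$ carries the standard symplectic form $\omega((q,p),(q',p'))=\langle q,p'\rangle-\langle p,q'\rangle$ and the standard complex structure $J_{2m}(q,p)=(-p,q)$, so that $\langle x,y\rangle_{\mathbb{R}^{2m}}=\omega(x,J_{2m}y)$ with $\langle\cdot,\cdot\rangle_{\mathbb{R}^{2m}}$ the Euclidean inner product. On $\mathbb{R}^{2}$ this form is denoted $\omega_0$. Lagrangian product: for $A,B\subset\mathbb{R}^{2}$, $A\times_L B=\{(q,p)\in\mathbb{R}^{2}\times\mathbb{R}^{2} : q\in A,\ p\in B\}\subset\mathbb{R}^{4}$, where $\mathbb{R}^{4}=\mathbb{R}^{2}_q\times\mathbb{R}^{2}_p$ has the standard symplectic form $\tilde\omega_0((q,p),(q',p'))=\langle q,p'\rangle_{\mathbb{R}^{2}}-\langle p,q'\rangle_{\mathbb{R}^{2}}$. Here $J_{2}K=\{J_{2}x: x\in K\}$. Ekeland–Hofer–Zehnder capacity: for a convex body $C\subset(\mathbb{R}^{2m},\omega)$, $c_{\rm EHZ}(C)$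 is the minimum of the action $A(\gamma)=\frac12\int_0^T\omega(\gamma(t),\dot\gamma(t))\,dt$ over all (generalized) closed characteristics on $\partial C$, i.e. non-constant absolutely continuous closed curves $\gamma:[0,T]\to\partial C$, $\gamma(0)=\gamma(T)$, with square-integrable derivative, such that $\dot\gamma(t)\in J_{2m}N_C(\gamma(t))$ for almost every $t$, where $N_C(x)=\{v:\langle v,y-x\rangle\le0\ \ \forall y\in C\}$ is the outer normal cone of $C$ at $x$. This coincides with the continuous extension (in the Hausdorff metric) to all convex bodies of the minimal action of closed characteristics on the boundary of smooth convex bodies. *)

theory Defs
  imports "HOL-Analysis.Analysis"
begin

(* A space \<real>\<^sup>2\<^sup>m = \<real>\<^sup>m_q \<times> \<real>\<^sup>m_p is a product type 'a \<times> 'a with 'a a Euclidean space of dimension m.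
   Thus \<real>\<^sup>2 is real \<times> real and \<real>\<^sup>4 = \<real>\<^sup>2_q \<times> \<real>\<^sup>2_p is (real \<times> real) \<times> (real \<times> real); the inner product
   and the Lebesgue measure of the library on these types are the Euclidean ones. *)

definition symplectic_form :: "'a::euclidean_space \<times> 'a \<Rightarrow> 'a \<times> 'a \<Rightarrow> real" where
  "symplectic_form x y = fst x \<bullet> snd y - snd x \<bullet> fst y"

definition complex_structure :: "'a::euclidean_space \<times> 'a \<Rightarrow> 'a \<times> 'a" where
  "complex_structure x = (- snd x, fst x)"

lemma inner_eq_symplectic_form: "x \<bullet> y = symplectic_form x (complex_structure y)"
  by (simp add: symplectic_form_def complex_structure_def inner_prod_def)

definition convex_body :: "'a::euclidean_space set \<Rightarrow> bool" where
  "convex_body C \<longleftrightarrow> compact C \<and> convex C \<and> interior C \<noteq> {}"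

definition lagrangian_product :: "'a set \<Rightarrow> 'a set \<Rightarrow> ('a \<times> 'a) set" where
  "lagrangian_product A B = {(q, p). q \<in> A \<and> p \<in> B}"

definition normal_cone :: "'a::real_inner set \<Rightarrow> 'a \<Rightarrow> 'a set" where
  "normal_cone C x = {v. \<forall>y\<in>C. v \<bullet> (y - x) \<le> 0}"

(* The library's absolutely_continuous is a relation between measures. *)
definition abs_continuous_curve :: "real \<Rightarrow> real \<Rightarrow> (real \<Rightarrow> 'a::metric_space) \<Rightarrow> bool" where
  "abs_continuous_curve s t \<gamma> \<longleftrightarrow>
     (\<forall>\<epsilon>>0. \<exists>\<delta>>0. \<forall>(n::nat) a b.
        (\<forall>i<n. s \<le> a i \<and> a i \<le> b i \<and> b i \<le> t) \<longrightarrow>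
        disjoint_family_on (\<lambda>i. {a i<..<b i}) {..<n} \<longrightarrow>
        (\<Sum>i<n. b i - a i) < \<delta> \<longrightarrow>
        (\<Sum>i<n. dist (\<gamma> (a i)) (\<gamma> (b i))) < \<epsilon>)"

abbreviation velocity :: "real \<Rightarrow> (real \<Rightarrow> 'a::real_normed_vector) \<Rightarrow> real \<Rightarrow> 'a" where
  "velocity T \<gamma> t \<equiv> vector_derivative \<gamma> (at t within {0..T})"

definition closed_characteristic ::
    "('a::euclidean_space \<times> 'a) set \<Rightarrow> real \<Rightarrow> (real \<Rightarrow> 'a \<times> 'a) \<Rightarrow> bool" where
  "closed_characteristic C T \<gamma> \<longleftrightarrow>
     0 < T \<and>
     \<gamma> ` {0..T} \<subseteq> frontier C \<and>
     \<gamma> 0 = \<gamma> T \<and>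
     \<not> \<gamma> constant_on {0..T} \<and>
     abs_continuous_curve 0 T \<gamma> \<and>
     integrable (lebesgue_on {0..T}) (\<lambda>t. (norm (velocity T \<gamma> t))\<^sup>2) \<and>
     (AE t in lebesgue_on {0..T}.
        \<gamma> differentiable (at t within {0..T}) \<and>
        velocity T \<gamma> t \<in> complex_structure ` normal_cone C (\<gamma> t))"

definition action :: "real \<Rightarrow> (real \<Rightarrow> 'a::euclidean_space \<times> 'a) \<Rightarrow> real" where
  "action T \<gamma> =
     1 / 2 * (\<integral>t. symplectic_form (\<gamma> t) (velocity T \<gamma> t) \<partial>lebesgue_on {0..T})"

(* The minimum is written as an infimum in the extended reals: it equals the minimum, which
   exists for convex bodies, and an empty set of characteristics would give \<infinity>, not a junk value. *)
definition c_EHZ :: "('a::euclidean_space \<times> 'a) set \<Rightarrow> ereal" where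
  "c_EHZ C = Inf {ereal (action T \<gamma>) | T \<gamma>. closed_characteristic C T \<gamma>}"

lemma c_EHZ_eq_minimum:
  assumes "closed_characteristic C T \<gamma>"
    and "\<And>S \<eta>. closed_characteristic C S \<eta> \<Longrightarrow> action T \<gamma> \<le> action S \<eta>"
  shows "c_EHZ C = ereal (action T \<gamma>)"
  unfolding c_EHZ_def
proof (rule Inf_eqI)
  fix y assume "\<And>i. i \<in> {ereal (action T \<gamma>) | T \<gamma>. closed_characteristic C T \<gamma>} \<Longrightarrow> y \<le> i"
  then show "y \<le> ereal (action T \<gamma>)" using assms(1) by blast
qed (use assms(2) in auto)

end

theory Submission
  imports Defs
begin

text \<open>
  The boundary of \<open>K\<close>, traversed clockwise by \<open>x\<close>, lifts to the closed characteristic \<open>(x, J x)\<close>: its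
  velocity \<open>(x', J x')\<close> lies in \<open>J (N \<times> J N)\<close>, with \<open>N\<close> the normal cone of \<open>K\<close> at \<open>x\<close>, as soon as
  \<open>J x' \<in> N\<close>, and its action is twice the area enclosed by \<open>x\<close>.

  Concretely \<open>x t = c + e t / h t\<close>, where \<open>e t = (sin t, cos t)\<close>, \<open>h t = g (e t)\<close> and \<open>g\<close> is the gauge of
  \<open>K - c\<close>. As a supremum of uniformly bounded sinusoids, \<open>h\<close> is convex up to a quadratic term, hence
  differentiable off a countable set; there a supporting functional \<open>u\<close> at \<open>x t\<close> satisfies
  \<open>J x' = u / h\<^sup>2\<close>. The action becomes the integral of \<open>1 / h\<^sup>2\<close>, which is twice the area in polar
  coordinates.
\<close>

section \<open>Gauge of a convex body and its supporting functionals\<close>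

text \<open>The gauge arises as the support function of the polar body of \<open>K - c\<close>. The
  polar body is compact, so each supremum is attained; a maximiser at \<open>z\<close> is the
  subgradient of the last clause, and the bound \<open>M\<close> on subgradients later serves as a
  Lipschitz constant of \<open>g\<close>.\<close>

lemma convex_body_gauge:
  fixes K :: "'a::euclidean_space set"
  assumes "compact K" "convex K" and c: "c \<in> interior K"
  obtains g :: "'a \<Rightarrow> real" and M where
    "\<And>a z. 0 \<le> a \<Longrightarrow> g (a *\<^sub>R z) = a * g z"
    "\<And>z. c + z \<in> K \<longleftrightarrow> g z \<le> 1"
    "\<And>z. z \<noteq> 0 \<Longrightarrow> 0 < g z"
    "\<And>z. \<exists>v. norm v \<le> M \<and> v \<bullet> z = g z \<and> (\<forall>w. v \<bullet> w \<le> g w)"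
proof -
  obtain \<rho> where \<rho>: "0 < \<rho>" "cball c \<rho> \<subseteq> K"
    using c by (auto simp: mem_interior_cball)
  have cK: "c \<in> K" using c interior_subset by blast
  obtain R where R: "0 < R" "\<And>y. y \<in> K \<Longrightarrow> norm (y - c) \<le> R"
  proof -
    obtain B where B: "\<forall>y\<in>K. norm y \<le> B"
      using \<open>compact K\<close> compact_imp_bounded bounded_iff by blast
    then have "norm (y - c) \<le> \<bar>B\<bar> + norm c + 1" if "y \<in> K" for y
      using that norm_triangle_ineq4[of y c] by fastforce
    then show thesis using that[of "\<bar>B\<bar> + norm c + 1"]
      by (metis abs_ge_zero add_nonneg_pos norm_ge_zero zero_less_one add_nonneg_nonneg)
  qed
  \<comment> \<open>\<open>P\<close> is the polar of \<open>K - c\<close> and \<open>g\<close> its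
    support function; that \<open>g\<close> is also the gauge is the bipolar theorem, proved below
    by separation.\<close>
  define P where "P = {v. \<forall>y\<in>K. v \<bullet> (y - c) \<le> 1}"
  define g where "g z = Sup ((\<lambda>v. v \<bullet> z) ` P)" for z
  have norm_P: "norm v \<le> 1 / \<rho>" if "v \<in> P" for v
  proof (cases "v = 0")
    case False
    \<comment> \<open>The point of the inscribed ball furthest in direction \<open>v\<close> is the
      sharpest test of \<open>v \<in> P\<close>.\<close>
    have "c + (\<rho> / norm v) *\<^sub>R v \<in> K"
      using \<rho> False by (intro subsetD[OF \<rho>(2)]) (simp add: dist_norm)
    with that have "v \<bullet> ((\<rho> / norm v) *\<^sub>R v) \<le> 1" by (force simp: P_def)
    also have "v \<bullet> ((\<rho> / norm v) *\<^sub>R v) = \<rho> * norm v"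
      using False by (simp add: dot_square_norm power2_eq_square)
    finally show ?thesis using \<rho> by (simp add: field_simps)
  qed (use \<rho> in simp)
  have "P = (\<Inter>y\<in>K. {v. (y - c) \<bullet> v \<le> 1})" by (auto simp: P_def inner_commute)
  then have "closed P" by (simp add: closed_INT closed_halfspace_le)
  then have P: "compact P" using norm_P by (auto simp: compact_eq_bounded_closed bounded_iff)
  have "0 \<in> P" by (simp add: P_def)
  have max: "\<exists>v\<in>P. \<forall>w\<in>P. w \<bullet> z \<le> v \<bullet> z" for z
    by (rule continuous_attains_sup[OF P]) (use \<open>0 \<in> P\<close> in \<open>auto intro!: continuous_intros\<close>)
  have att: "\<exists>v\<in>P. v \<bullet> z = g z \<and> (\<forall>w\<in>P. w \<bullet> z \<le> g z)" for z
  proof -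
    obtain v where v: "v \<in> P" "\<And>w. w \<in> P \<Longrightarrow> w \<bullet> z \<le> v \<bullet> z" using max[of z] by blast
    then have "g z = v \<bullet> z" unfolding g_def by (intro cSup_eq_maximum) auto
    with v show ?thesis by auto
  qed
  show thesis
  proof (rule that)
    show "g (a *\<^sub>R z) = a * g z" if "0 \<le> a" for a z
    proof (rule antisym)
      obtain v where "v \<in> P" "v \<bullet> (a *\<^sub>R z) = g (a *\<^sub>R z)" using att by blast
      moreover from this have "v \<bullet> z \<le> g z" using att by blast
      ultimately show "g (a *\<^sub>R z) \<le> a * g z"
        using that by (metis inner_scaleR_right mult_left_mono)
      obtain v where "v \<in> P" "v \<bullet> z = g z" using att by blast
      moreover from this have "v \<bullet> (a *\<^sub>R z) \<le> g (a *\<^sub>R z)" using att by blast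
      ultimately show "a * g z \<le> g (a *\<^sub>R z)" by simp
    qed
    show "c + z \<in> K \<longleftrightarrow> g z \<le> 1" for z
    proof
      assume "c + z \<in> K"
      moreover obtain v where "v \<in> P" "v \<bullet> z = g z" using att by blast
      ultimately show "g z \<le> 1" by (force simp: P_def)
    next
      assume le: "g z \<le> 1"
      show "c + z \<in> K"
      \<comment> \<open>A hyperplane separating \<open>c + z\<close> from \<open>K\<close>, rescaled
        by its distance parameter \<open>\<beta>\<close> from \<open>c\<close>, would be an element
        of \<open>P\<close> with value above 1 at \<open>z\<close>.\<close>
      proof (rule ccontr)
        assume "c + z \<notin> K"
        then obtain a b where ab: "a \<bullet> (c + z) < b" "\<And>y. y \<in> K \<Longrightarrow> b < a \<bullet> y"
          using separating_hyperplane_closed_point[of K "c + z"] assms compact_imp_closed by blast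
        define \<beta> where "\<beta> = a \<bullet> c - b"
        have \<beta>: "0 < \<beta>" using ab(2)[OF cK] by (simp add: \<beta>_def)
        have "(- a) \<bullet> (y - c) \<le> \<beta>" if "y \<in> K" for y
          using ab(2)[OF that] by (simp add: \<beta>_def algebra_simps)
        then have "(- (1 / \<beta>)) *\<^sub>R a \<in> P"
          using \<beta> by (force simp: P_def field_simps)
        then have "((- (1 / \<beta>)) *\<^sub>R a) \<bullet> z \<le> 1" using att le order_trans by blast
        then have "- (a \<bullet> z) \<le> \<beta>" using \<beta> by (simp add: field_simps)
        then show False using ab(1) by (simp add: \<beta>_def algebra_simps)
      qed
    qed
    show "0 < g z" if "z \<noteq> 0" for z
    proof -
      \<comment> \<open>As \<open>K - c\<close> lies in the ball of radius \<open>R\<close>, this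
        multiple of \<open>z\<close> belongs to the polar body, and it is positive on
        \<open>z\<close>.\<close>
      have "(1 / (R * norm z)) *\<^sub>R z \<in> P"
        unfolding P_def
      proof safe
        fix y assume "y \<in> K"
        have "z \<bullet> (y - c) \<le> norm z * R"
          using norm_cauchy_schwarz[of z "y - c"] R(2)[OF \<open>y \<in> K\<close>]
          by (meson mult_left_mono norm_ge_zero order_trans)
        then show "(1 / (R * norm z)) *\<^sub>R z \<bullet> (y - c) \<le> 1"
          using R that by (simp add: field_simps)
      qed
      then have "((1 / (R * norm z)) *\<^sub>R z) \<bullet> z \<le> g z" using att by blast
      moreover have "0 < ((1 / (R * norm z)) *\<^sub>R z) \<bullet> z" using R that by simp
      ultimately show ?thesis by linarith
    qed
    show "\<exists>v. norm v \<le> 1 / \<rho> \<and> v \<bullet> z = g z \<and> (\<forall>w. v \<bullet> w \<le> g w)" for z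
      using att norm_P by meson
  qed
qed

section \<open>Derivatives of convex functions and of periodic Lipschitz curves\<close>

text \<open>A choice \<open>d\<close> of subgradients is monotone, hence continuous off a countable
  set. The difference quotient of \<open>f\<close> between \<open>t\<close> and \<open>t + u\<close>
  lies between \<open>d t\<close> and \<open>d (t + u)\<close>, so it converges wherever
  \<open>d\<close> is continuous.\<close>

lemma subgradient_imp_differentiable:
  fixes f d :: "real \<Rightarrow> real"
  assumes sub: "\<And>s t. f t + d t * (s - t) \<le> f s"
  shows "countable {t. \<not> (f has_real_derivative d t) (at t)}"
proof -
  have "mono d"
  proof (rule monoI)
    fix s t :: real assume "s \<le> t"
    show "d s \<le> d t"
    proof (cases "s = t")
      case False
      with \<open>s \<le> t\<close> have "0 < t - s" by simp
      have "d s * (t - s) \<le> d t * (t - s)" using sub[of s t] sub[of t s] by (simp add: algebra_simps)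
      then show ?thesis using \<open>0 < t - s\<close> mult_le_cancel_right_pos by blast
    qed simp
  qed
  have "(f has_real_derivative d t) (at t)" if "isCont d t" for t
    unfolding DERIV_def
  proof (rule LIM_zero_cancel, rule Lim_null_comparison)
    show "((\<lambda>u. \<bar>d (t + u) - d t\<bar>) \<longlongrightarrow> 0) (at 0)"
      using that by (simp add: isCont_iff LIM_zero_iff tendsto_rabs_zero)
    have "norm ((f (t + u) - f t) / u - d t) \<le> \<bar>d (t + u) - d t\<bar>" if "u \<noteq> 0" for u
    proof -
      have *: "d t * u \<le> f (t + u) - f t" "f (t + u) - f t \<le> d (t + u) * u"
        using sub[of t "t + u"] sub[of "t + u" t] by (simp_all add: algebra_simps)
      show ?thesis
      proof (cases "0 < u")
        case True
        with * have "d t \<le> (f (t + u) - f t) / u" "(f (t + u) - f t) / u \<le> d (t + u)"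
          by (simp_all add: field_simps)
        then show ?thesis by simp
      next
        case False
        with that * have "(f (t + u) - f t) / u \<le> d t" "d (t + u) \<le> (f (t + u) - f t) / u"
          by (simp_all add: field_simps)
        then show ?thesis by simp
      qed
    qed
    then show "\<forall>\<^sub>F u in at 0. norm ((f (t + u) - f t) / u - d t) \<le> \<bar>d (t + u) - d t\<bar>"
      by (auto simp: eventually_at_filter)
  qed
  then have "{t. \<not> (f has_real_derivative d t) (at t)} \<subseteq> {t. \<not> isCont d t}" by blast
  then show ?thesis using mono_ctble_discont[OF \<open>mono d\<close>] countable_subset by blast
qed

text \<open>This stands in for the fundamental theorem of calculus on a closed curve that is
  differentiable only almost everywhere. It makes the velocity integrable and bounded, and removes
  from the action the term linear in the velocity.\<close>

lemma periodic_Lipschitz_derivative: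
  fixes f f' :: "real \<Rightarrow> 'a::euclidean_space"
  assumes "0 < T"
    and lip: "\<And>s t. norm (f s - f t) \<le> L * \<bar>s - t\<bar>"
    and per: "\<And>t. f (t + T) = f t"
    and N: "negligible N"
    and deriv: "\<And>t. t \<in> {0..T} - N \<Longrightarrow> (f has_vector_derivative f' t) (at t)"
  shows "integrable (lebesgue_on {0..T}) f'" "(f' has_integral 0) {0..T}"
    "\<And>t. t \<in> {0..T} - N \<Longrightarrow> norm (f' t) \<le> L"
proof -
  define q where "q n t = real (Suc n) *\<^sub>R (f (t + 1 / real (Suc n)) - f t)" for n t
  have "0 \<le> L" using order_trans[OF norm_ge_zero lip[of 1 0]] by simp
  then have cont: "continuous_on S f" for S
    using lip by (intro lipschitz_on_continuous_on[of L] lipschitz_onI) (auto simp: dist_norm)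
  have contq: "continuous_on S (q n)" for S n
    unfolding q_def by (intro continuous_intros continuous_on_compose2[OF cont[of UNIV]]) auto
  have int: "f integrable_on {a..b}" for a b
    by (rule integrable_continuous_interval[OF cont])
  \<comment> \<open>The difference quotients have vanishing integral over a period, and they converge boundedly.\<close>
  have q0: "(q n has_integral 0) {0..T}" for n
  proof -
    define \<epsilon> where "\<epsilon> = 1 / real (Suc n)"
    have \<epsilon>: "0 \<le> \<epsilon>" by (simp add: \<epsilon>_def)
    have shift: "((\<lambda>t. f (t + c)) has_integral integral {a + c..b + c} f) {a..b}" for a b c
      using has_integral_affinity'[OF integrable_integral[OF int[of "a + c" "b + c"], folded cbox_interval], of 1 c]
      by simp
    \<comment> \<open>By periodicity the piece gained at the right end of the shifted window equals
      the piece lost at the left end.\<close>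
    have "integral {T..T + \<epsilon>} f = integral {0..\<epsilon>} f"
      using integral_unique[OF shift[of T 0 \<epsilon>]] per by (simp add: add.commute)
    moreover have "integral {0..\<epsilon>} f + integral {\<epsilon>..T + \<epsilon>} f = integral {0..T + \<epsilon>} f"
      using \<epsilon> \<open>0 < T\<close> by (intro Henstock_Kurzweil_Integration.integral_combine int) auto
    moreover have "integral {0..T} f + integral {T..T + \<epsilon>} f = integral {0..T + \<epsilon>} f"
      using \<epsilon> \<open>0 < T\<close> by (intro Henstock_Kurzweil_Integration.integral_combine int) auto
    ultimately have "integral {\<epsilon>..T + \<epsilon>} f = integral {0..T} f"
      by (metis add.commute add_left_imp_eq)
    then have "((\<lambda>t. f (t + \<epsilon>)) has_integral integral {0..T} f) {0..T}"
      using shift[of \<epsilon> 0 T] by simp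
    from has_integral_cmul[OF has_integral_diff[OF this integrable_integral[OF int]], of "real (Suc n)"]
    show ?thesis by (simp add: q_def[abs_def] \<epsilon>_def del: of_nat_Suc)
  qed
  have bound: "norm (q n t) \<le> L" for n t
  proof -
    have "norm (q n t) = real (Suc n) * norm (f (t + 1 / real (Suc n)) - f t)"
      by (simp add: q_def del: of_nat_Suc)
    also have "\<dots> \<le> real (Suc n) * (L * \<bar>t + 1 / real (Suc n) - t\<bar>)"
      by (intro mult_left_mono lip) auto
    also have "\<dots> = L" by (simp del: of_nat_Suc)
    finally show ?thesis .
  qed
  have lim: "(\<lambda>n. q n t) \<longlonglongrightarrow> f' t" if "t \<in> {0..T} - N" for t
  proof -
    have "((\<lambda>u. (f (t + u) - f t) /\<^sub>R u) \<longlongrightarrow> f' t) (at 0)"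
    proof (rule LIM_zero_cancel, rule tendsto_norm_zero_cancel, rule Lim_transform_eventually)
      show "((\<lambda>u. norm (f (t + u) - f t - u *\<^sub>R f' t) / norm u) \<longlongrightarrow> 0) (at 0)"
        using deriv[OF that] by (simp add: has_vector_derivative_def has_derivative_at)
      have "norm (f (t + u) - f t - u *\<^sub>R f' t) / norm u = norm ((f (t + u) - f t) /\<^sub>R u - f' t)"
        if "u \<noteq> 0" for u
      proof -
        have "(f (t + u) - f t) /\<^sub>R u - f' t = (f (t + u) - f t - u *\<^sub>R f' t) /\<^sub>R u"
          using that by (simp add: algebra_simps)
        then show ?thesis by (simp add: divide_inverse)
      qed
      then show "\<forall>\<^sub>F u in at 0. norm (f (t + u) - f t - u *\<^sub>R f' t) / norm u =
          norm ((f (t + u) - f t) /\<^sub>R u - f' t)"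
        by (auto simp: eventually_at_filter)
    qed
    moreover have "filterlim (\<lambda>n. 1 / real (Suc n)) (at 0) sequentially"
      unfolding filterlim_at using LIMSEQ_inverse_real_of_nat by (simp add: inverse_eq_divide)
    ultimately show ?thesis
      by (auto dest: filterlim_compose simp: q_def)
  qed
  \<comment> \<open>Nothing is known about \<open>f'\<close> on \<open>N\<close>, so the convergence
    theorems are applied off \<open>N\<close> and their conclusions carried back across a null
    set.\<close>
  let ?S = "{0..T} - N"
  have spike: "(h has_integral i) ?S \<longleftrightarrow> (h has_integral i) {0..T}" for h :: "real \<Rightarrow> 'b::euclidean_space" and i
    by (rule has_integral_spike_set_eq) (auto intro: negligible_subset[OF N])
  have constS: "(\<lambda>t. L) integrable_on ?S"
    using spike[of "\<lambda>t. L"] integrable_const_ivl[of L 0 T] unfolding integrable_on_def by blast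
  have "(f' has_integral 0) ?S"
    by (rule has_integral_dominated_convergence[where f=q and h="\<lambda>t. L" and y="\<lambda>_. 0"])
      (use q0 bound lim constS in \<open>auto simp: spike\<close>)
  then show "(f' has_integral 0) {0..T}" by (simp add: spike)
  show bound': "norm (f' t) \<le> L" if "t \<in> ?S" for t
    by (rule LIMSEQ_le_const2[OF tendsto_norm[OF lim[OF that]]]) (use bound in auto)
  have "f' absolutely_integrable_on ?S"
  proof (rule dominated_convergence_absolutely_integrable[OF _ constS _ lim])
    show "q k absolutely_integrable_on ?S" for k
      using absolutely_integrable_spike_set_eq[of ?S "{0..T}" "q k"]
        absolutely_integrable_continuous_real[OF contq]
      by (auto intro: negligible_subset[OF N])
  qed (rule bound')
  then have "f' absolutely_integrable_on {0..T}"
    using absolutely_integrable_spike_set_eq[of ?S "{0..T}" f']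
    by (auto intro: negligible_subset[OF N])
  then show "integrable (lebesgue_on {0..T}) f'"
    by (simp add: integrable_restrict_space set_integrable_def)
qed

section \<open>Area in polar coordinates\<close>

text \<open>Apart from the point 0, where the weight vanishes, \<open>S\<close> is the interval from
  \<open>- 1 / b\<close> to \<open>1 / a\<close>. It will be the trace of the body on a line through
  the origin, and the weight is the Jacobian of the slope coordinates.\<close>

lemma nn_integral_abs_cone:
  fixes S :: "real set" and a b :: real
  assumes "0 < a" "0 < b" and S: "\<And>x. 0 < x \<Longrightarrow> x \<in> S \<longleftrightarrow> x * a \<le> 1"
    "\<And>x. x < 0 \<Longrightarrow> x \<in> S \<longleftrightarrow> - x * b \<le> 1"
  shows "(\<integral>\<^sup>+x. ennreal \<bar>x\<bar> * indicator S x \<partial>lborel) = ennreal ((1 / a\<^sup>2 + 1 / b\<^sup>2) / 2)"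
proof -
  have eq: "ennreal \<bar>x\<bar> * indicator S x =
      ennreal x * indicator {0..1 / a} x + ennreal (- x) * indicator {- (1 / b)..0} x" for x
    using S[of x] assms(1,2) by (cases x "0::real" rule: linorder_cases)
      (auto simp: indicator_def field_simps ennreal_neg)
  have "(\<integral>\<^sup>+x. ennreal x * indicator {0..1 / a} x \<partial>lborel) = ennreal ((1 / a)\<^sup>2 / 2 - 0\<^sup>2 / 2)"
    by (rule nn_integral_FTC_Icc) (use assms in \<open>auto intro!: derivative_eq_intros\<close>)
  moreover have "(\<integral>\<^sup>+x. ennreal (- x) * indicator {- (1 / b)..0} x \<partial>lborel) =
      ennreal (- (0\<^sup>2 / 2) - - ((- (1 / b))\<^sup>2 / 2))"
    by (rule nn_integral_FTC_Icc) (use assms in \<open>auto intro!: derivative_eq_intros\<close>)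
  ultimately show ?thesis
    using assms(1,2) unfolding eq
    by (subst nn_integral_add) (auto simp: power_divide add_divide_distrib simp flip: ennreal_plus)
qed

text \<open>The map \<open>- cot\<close> is a bijection from the open interval
  \<open>(0, pi)\<close> to the reals with derivative \<open>1 / (sin t)\<^sup>2\<close>; it turns
  integrals over slopes into integrals over angles. Nonnegativity supplies the absolute
  integrability that the change of variables asks for.\<close>

lemma has_integral_cot_substitution:
  fixes f :: "real \<Rightarrow> real"
  assumes "((\<lambda>t. f (- cot t) / (sin t)\<^sup>2) has_integral i) {0..pi}" and nonneg: "\<And>x. 0 \<le> f x"
  shows "(f has_integral i) UNIV"
proof -
  let ?S = "{0<..<pi}"
  have sin: "sin t \<noteq> 0" if "t \<in> ?S" for t using sin_gt_zero[of t] that by auto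
  have surj: "(\<lambda>t. - cot t) ` ?S = UNIV"
  proof -
    have "x \<in> (\<lambda>t. - cot t) ` ?S" for x :: real
    proof (rule image_eqI)
      show "x = - cot (arctan x + pi / 2)"
        using tan_arctan[of x] by (simp add: cot_def sin_add cos_add tan_def)
      show "arctan x + pi / 2 \<in> ?S" using arctan_bounded[of x] by auto
    qed
    then show ?thesis by blast
  qed
  have inj: "inj_on (\<lambda>t. - cot t) ?S"
  proof (rule inj_onI)
    fix s t assume st: "s \<in> ?S" "t \<in> ?S" and "- cot s = - cot t"
    \<comment> \<open>Shifting by \<open>pi / 2\<close> turns \<open>- cot\<close> into
      \<open>tan\<close> on the interval where \<open>arctan\<close> inverts it.\<close>
    then have "tan (s - pi / 2) = tan (t - pi / 2)"
      by (simp add: tan_def sin_diff cos_diff cot_def)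
    then have "arctan (tan (s - pi / 2)) = arctan (tan (t - pi / 2))" by simp
    then show "s = t" using st by (subst (asm) (1 2) arctan_tan) auto
  qed
  have deriv: "((\<lambda>t. - cot t) has_field_derivative 1 / (sin t)\<^sup>2) (at t within ?S)" if "t \<in> ?S" for t
    using DERIV_minus[OF DERIV_cot[OF sin[OF that]]]
    by (simp add: divide_inverse has_field_derivative_at_within)
  have "((\<lambda>t. \<bar>1 / (sin t)\<^sup>2\<bar> * f (- cot t)) has_integral i) ?S"
    using assms(1) has_integral_open_interval[of _ i 0 pi] by (simp add: mult.commute)
  moreover from this have "(\<lambda>t. \<bar>1 / (sin t)\<^sup>2\<bar> * f (- cot t)) absolutely_integrable_on ?S"
    by (intro nonnegative_absolutely_integrable_1) (auto simp: nonneg)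
  ultimately have "f absolutely_integrable_on UNIV \<and> integral UNIV f = i"
    using has_absolute_integral_change_of_variables_1'[of ?S "\<lambda>t. - cot t" "\<lambda>t. 1 / (sin t)\<^sup>2" f i,
        OF _ deriv inj] surj by (simp add: has_integral_iff)
  then show ?thesis by (metis absolutely_integrable_on_def integrable_integral)
qed

text \<open>The plane is swept by lines \<open>y = - m x\<close> rather than by rays: substituting
  \<open>y = - x * m\<close> in the vertical slices and exchanging the integrals leaves the double
  sectors \<open>\<phi> m\<close>, and \<open>m = - cot t\<close> brings in the angle. Each line
  carries the two rays at angles \<open>t\<close> and \<open>t + pi\<close>.\<close>

lemma has_integral_polar_area:
  fixes g :: "real \<times> real \<Rightarrow> real"
  assumes hom: "\<And>a z. 0 \<le> a \<Longrightarrow> g (a *\<^sub>R z) = a * g z"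
    and pos: "\<And>z. z \<noteq> 0 \<Longrightarrow> 0 < g z"
    and cont: "continuous_on UNIV g"
  shows "((\<lambda>t. 1 / (g (sin t, cos t))\<^sup>2) has_integral 2 * measure lborel {z. g z \<le> 1}) {0..2 * pi}"
proof -
  let ?S = "{z. g z \<le> 1}"
  let ?h = "\<lambda>t. g (sin t, cos t)"
  \<comment> \<open>Up to \<open>dm\<close>, \<open>\<phi> m\<close> is the area of the double sector swept by the line \<open>y = - m x\<close>.\<close>
  define \<phi> where "\<phi> m = (1 / (g (1, - m))\<^sup>2 + 1 / (g (- 1, m))\<^sup>2) / 2" for m
  have S[measurable]: "?S \<in> sets borel"
    by (intro borel_closed closed_Collect_le cont continuous_intros)
  have g[measurable]: "g \<in> borel_measurable borel"
    by (rule borel_measurable_continuous_onI[OF cont])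
  have pos_h: "0 < ?h t" for t
    by (rule pos) (metis Pair_inject zero_prod_def sin_zero_abs_cos_one abs_zero zero_neq_one)
  have cont_h: "continuous_on A ?h" for A
    by (rule continuous_on_compose2[OF cont]) (auto intro!: continuous_intros)
  define I where "I a b = integral {a..b} (\<lambda>t. 1 / (?h t)\<^sup>2)" for a b
  have I: "((\<lambda>t. 1 / (?h t)\<^sup>2) has_integral I a b) {a..b}" for a b
    unfolding I_def using pos_h
    by (intro integrable_integral integrable_continuous_interval continuous_intros cont_h)
      (metis less_irrefl power_not_zero)
  have I2: "((\<lambda>t. 1 / (?h (t + pi))\<^sup>2) has_integral I pi (2 * pi)) {0..pi}"
    using has_integral_affinity'[OF I[of pi "2 * pi", folded cbox_interval], of 1 pi] by simp

  have "(\<phi> has_integral (I 0 pi + I pi (2 * pi)) / 2) UNIV"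
  proof (rule has_integral_cot_substitution)
    have "((\<lambda>t. (1 / (?h t)\<^sup>2 + 1 / (?h (t + pi))\<^sup>2) / 2) has_integral (I 0 pi + I pi (2 * pi)) / 2) {0..pi}"
      by (intro has_integral_divide has_integral_add I I2)
    \<comment> \<open>Scaling by \<open>sin t\<close> requires it to be positive, which excludes the
      two endpoints.\<close>
    then show "((\<lambda>t. \<phi> (- cot t) / (sin t)\<^sup>2) has_integral (I 0 pi + I pi (2 * pi)) / 2) {0..pi}"
    proof (rule has_integral_spike_finite[rotated 2])
      fix t assume "t \<in> {0..pi} - {0, pi}"
      then have s: "0 < sin t" using sin_gt_zero[of t] by auto
      have "g (sin t *\<^sub>R (1, cot t)) = sin t * g (1, cot t)"
        "g (sin t *\<^sub>R (- 1, - cot t)) = sin t * g (- 1, - cot t)" using s by (intro hom; simp)+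
      then have "?h t = sin t * g (1, cot t)" "?h (t + pi) = sin t * g (- 1, - cot t)"
        using s by (simp_all add: cot_def)
      then show "\<phi> (- cot t) / (sin t)\<^sup>2 = (1 / (?h t)\<^sup>2 + 1 / (?h (t + pi))\<^sup>2) / 2"
        using s by (simp add: \<phi>_def power_mult_distrib field_simps)
    qed simp
  qed (simp add: \<phi>_def)
  moreover have "\<phi> \<in> borel_measurable borel" unfolding \<phi>_def by measurable
  ultimately have "(\<integral>\<^sup>+m. ennreal (\<phi> m) \<partial>lborel) = ennreal ((I 0 pi + I pi (2 * pi)) / 2)"
    using nn_integral_has_integral_lborel[of \<phi> "(I 0 pi + I pi (2 * pi)) / 2"]
    by (simp add: \<phi>_def)
  also have "(\<integral>\<^sup>+m. ennreal (\<phi> m) \<partial>lborel) =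
      (\<integral>\<^sup>+m. (\<integral>\<^sup>+x. ennreal \<bar>x\<bar> * indicator ?S (x, - x * m) \<partial>lborel) \<partial>lborel)"
  proof (rule nn_integral_cong)
    fix m :: real
    have "x * g (1, - m) = g (x, - x * m)" if "0 < x" for x
      using hom[of x "(1, - m)"] that by simp
    moreover have "- x * g (- 1, m) = g (x, - x * m)" if "x < 0" for x
      using hom[of "- x" "(- 1, m)"] that by simp
    ultimately have "(\<integral>\<^sup>+x. ennreal \<bar>x\<bar> * indicator {x. g (x, - x * m) \<le> 1} x \<partial>lborel) = ennreal (\<phi> m)"
      unfolding \<phi>_def by (intro nn_integral_abs_cone pos) (auto simp: zero_prod_def)
    then show "ennreal (\<phi> m) = (\<integral>\<^sup>+x. ennreal \<bar>x\<bar> * indicator ?S (x, - x * m) \<partial>lborel)"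
      by (simp add: indicator_def)
  qed
  also have "\<dots> = (\<integral>\<^sup>+x. (\<integral>\<^sup>+m. ennreal \<bar>x\<bar> * indicator ?S (x, - x * m) \<partial>lborel) \<partial>lborel)"
    by (rule lborel_pair.Fubini') measurable
  \<comment> \<open>For nonzero \<open>x\<close> the substitution \<open>y = - x * m\<close> absorbs
    the factor \<open>\<bar>x\<bar>\<close>; it degenerates only on the null set
    \<open>x = 0\<close>.\<close>
  also have "\<dots> = (\<integral>\<^sup>+x. (\<integral>\<^sup>+y. indicator ?S (x, y) \<partial>lborel) \<partial>lborel)"
  proof (rule nn_integral_cong_AE, rule AE_mp[OF AE_lborel_singleton[of 0]], rule AE_I2, rule impI)
    fix x :: real assume "x \<noteq> 0"
    then show "(\<integral>\<^sup>+m. ennreal \<bar>x\<bar> * indicator ?S (x, - x * m) \<partial>lborel) = (\<integral>\<^sup>+y. indicator ?S (x, y) \<partial>lborel)"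
      by (subst (2) nn_integral_real_affine[of _ "- x" 0]) (auto simp: nn_integral_cmult)
  qed
  also have "\<dots> = (\<integral>\<^sup>+z. indicator ?S z \<partial>(lborel \<Otimes>\<^sub>M lborel))"
    by (rule lborel.nn_integral_fst) (simp add: lborel_prod)
  also have "\<dots> = emeasure lborel ?S" by (simp add: lborel_prod)
  finally have "emeasure lborel ?S = ennreal ((I 0 pi + I pi (2 * pi)) / 2)" by simp
  moreover have "0 \<le> I a b" for a b
    by (rule has_integral_nonneg[OF I]) simp
  ultimately have "2 * measure lborel ?S = I 0 pi + I pi (2 * pi)"
    by (simp add: measure_def)
  with has_integral_combine[OF _ _ I[of 0 pi] I[of pi "2 * pi"]] show ?thesis by simp
qed

section \<open>Absolute continuity, the complex structure and the unit circle\<close>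

lemma Lipschitz_imp_abs_continuous_curve:
  assumes lip: "\<And>s t. dist (\<gamma> s) (\<gamma> t) \<le> L * \<bar>s - t\<bar>"
  shows "abs_continuous_curve a b \<gamma>"
  unfolding abs_continuous_curve_def
proof (intro allI impI)
  fix \<epsilon> :: real assume "0 < \<epsilon>"
  have "0 \<le> L" using order_trans[OF zero_le_dist lip[of 1 0]] by simp
  \<comment> \<open>Dividing by \<open>L + 1\<close> instead of \<open>L\<close> covers
    \<open>L = 0\<close>.\<close>
  have "(\<Sum>i<n. dist (\<gamma> (p i)) (\<gamma> (q i))) < \<epsilon>"
    if pq: "\<forall>i<n. a \<le> p i \<and> p i \<le> q i \<and> q i \<le> b" and less: "(\<Sum>i<n. q i - p i) < \<epsilon> / (L + 1)"
    for n :: nat and p q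
  proof -
    have "(\<Sum>i<n. dist (\<gamma> (p i)) (\<gamma> (q i))) \<le> (\<Sum>i<n. L * (q i - p i))"
    proof (rule sum_mono)
      fix i assume "i \<in> {..<n}"
      then show "dist (\<gamma> (p i)) (\<gamma> (q i)) \<le> L * (q i - p i)"
        using lip[of "p i" "q i"] pq by (simp add: abs_minus_commute)
    qed
    also have "\<dots> \<le> (L + 1) * (\<Sum>i<n. q i - p i)"
      unfolding sum_distrib_left using pq \<open>0 \<le> L\<close> by (intro sum_mono mult_right_mono) auto
    also have "\<dots> < \<epsilon>" using less \<open>0 \<le> L\<close> by (simp add: field_simps)
    finally show ?thesis .
  qed
  then show "\<exists>\<delta>>0. \<forall>(n::nat) p q. (\<forall>i<n. a \<le> p i \<and> p i \<le> q i \<and> q i \<le> b) \<longrightarrow>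
        disjoint_family_on (\<lambda>i. {p i<..<q i}) {..<n} \<longrightarrow> (\<Sum>i<n. q i - p i) < \<delta> \<longrightarrow>
        (\<Sum>i<n. dist (\<gamma> (p i)) (\<gamma> (q i))) < \<epsilon>"
    using \<open>0 < \<epsilon>\<close> \<open>0 \<le> L\<close> by (intro exI[of _ "\<epsilon> / (L + 1)"]) auto
qed

lemma AE_lebesgue_on_Diff:
  assumes "negligible N" "S \<in> sets lebesgue" "\<And>x. x \<in> S - N \<Longrightarrow> P x"
  shows "AE x in lebesgue_on S. P x"
proof -
  have "AE x in lebesgue. x \<notin> N"
    using assms(1) by (intro AE_not_in) (simp add: negligible_iff_null_sets)
  then have "AE x in lebesgue. x \<in> S \<longrightarrow> P x" by eventually_elim (use assms(3) in auto)
  then show ?thesis using assms(2) by (subst AE_restrict_space_iff) auto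
qed

lemma bounded_linear_complex_structure: "bounded_linear complex_structure"
  unfolding complex_structure_def
  by (intro bounded_linear_Pair bounded_linear_minus bounded_linear_fst bounded_linear_snd)

lemma inner_complex_structure: "complex_structure x \<bullet> complex_structure y = x \<bullet> y"
  by (simp add: complex_structure_def inner_prod_def)

lemma norm_complex_structure: "norm (complex_structure x) = norm x"
  by (simp add: norm_eq_sqrt_inner inner_complex_structure)

text \<open>In the orthonormal frame at angle \<open>t\<close> the chord has coordinates
  \<open>cos u - 1\<close> and \<open>sin u\<close>. The second estimate is a Taylor remainder, each
  coordinate contributing at most \<open>u\<^sup>2 / 2\<close>; it fixes the size of the quadratic
  term that makes the radial function convex.\<close>

lemma circle_difference:
  fixes s t :: real
  shows "norm ((sin s, cos s) - (sin t, cos t)) \<le> 2 * \<bar>s - t\<bar>"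
    and "norm ((sin s, cos s) - (sin t, cos t) - (s - t) *\<^sub>R (cos t, - sin t)) \<le> (s - t)\<^sup>2"
proof -
  define u where "u = s - t"
  have s: "s = t + u" by (simp add: u_def)
  have norm: "norm (a *\<^sub>R (sin t, cos t) + b *\<^sub>R (cos t, - sin t)) \<le> \<bar>a\<bar> + \<bar>b\<bar>" for a b
    by (rule order_trans[OF norm_triangle_ineq]) (simp add: norm_Pair del: scaleR_Pair)
  have cos: "\<bar>cos u - 1\<bar> = 2 * \<bar>sin (u / 2)\<bar> * \<bar>sin (u / 2)\<bar>"
    using cos_double_sin[of "u / 2"] by (simp add: power2_eq_square abs_mult)
  have half: "\<bar>sin (u / 2)\<bar> \<le> \<bar>u\<bar> / 2" using abs_sin_x_le_abs_x[of "u / 2"] by simp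
  have "\<bar>cos u - 1\<bar> \<le> \<bar>u\<bar>"
    unfolding cos using mult_mono[OF half abs_sin_le_one[of "u / 2"]] by simp
  moreover have "(sin s, cos s) - (sin t, cos t) =
      (cos u - 1) *\<^sub>R (sin t, cos t) + sin u *\<^sub>R (cos t, - sin t)"
    unfolding s by (simp add: sin_add cos_add algebra_simps)
  ultimately show "norm ((sin s, cos s) - (sin t, cos t)) \<le> 2 * \<bar>s - t\<bar>"
    using norm[of "cos u - 1" "sin u"] abs_sin_x_le_abs_x[of u] by (simp add: u_def)
  have "\<bar>cos u - 1\<bar> \<le> u\<^sup>2 / 2"
    unfolding cos using mult_mono[OF half half] by (simp add: power2_eq_square)
  moreover have "\<bar>sin u - u\<bar> \<le> u\<^sup>2 / 2"
    using Maclaurin_sin_bound[of u 2] by (simp add: numeral_2_eq_2 sin_coeff_def)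
  moreover have "(sin s, cos s) - (sin t, cos t) - (s - t) *\<^sub>R (cos t, - sin t) =
      (cos u - 1) *\<^sub>R (sin t, cos t) + (sin u - u) *\<^sub>R (cos t, - sin t)"
    unfolding s by (simp add: sin_add cos_add algebra_simps)
  ultimately show "norm ((sin s, cos s) - (sin t, cos t) - (s - t) *\<^sub>R (cos t, - sin t)) \<le> (s - t)\<^sup>2"
    using norm[of "cos u - 1" "sin u - u"] by (simp add: u_def)
qed

lemma frontier_lagrangian_product:
  fixes K L :: "'a::euclidean_space set"
  assumes "x \<in> K" "x \<notin> interior K" "y \<in> L"
  shows "(x, y) \<in> frontier (lagrangian_product K L)"
proof -
  have "lagrangian_product K L = K \<times> L" by (auto simp: lagrangian_product_def)
  then show ?thesis using assms closure_subset[of "K \<times> L"] by (auto simp: frontier_def interior_Times)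
qed

section \<open>The lifted boundary curve and its action\<close>

theorem corollary1p2:
  fixes K :: "(real \<times> real) set"
  assumes "convex_body K"
  shows "c_EHZ (lagrangian_product K (complex_structure ` K)) \<le> ereal (2 * measure lebesgue K)"
proof -
  let ?J = complex_structure
  let ?C = "lagrangian_product K (?J ` K)"
  have K: "compact K" "convex K" using assms by (auto simp: convex_body_def)
  obtain c where c: "c \<in> interior K" using assms by (auto simp: convex_body_def)
  obtain g M where hom: "\<And>a z. 0 \<le> a \<Longrightarrow> g (a *\<^sub>R z) = a * g z"
    and mem: "\<And>z. c + z \<in> K \<longleftrightarrow> g z \<le> 1"
    and pos: "\<And>z. z \<noteq> 0 \<Longrightarrow> 0 < g z"
    and supp: "\<And>z. \<exists>v. norm v \<le> M \<and> v \<bullet> z = g z \<and> (\<forall>w. v \<bullet> w \<le> g w)"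
    using convex_body_gauge[OF K c] by blast
  obtain B where B: "\<And>y. y \<in> K \<Longrightarrow> norm y \<le> B"
    using compact_imp_bounded[OF K(1)] by (auto simp: bounded_iff)
  \<comment> \<open>\<open>R\<close> bounds \<open>K - c\<close>, and therefore also
    \<open>1 / h t\<close>, the distance from \<open>c\<close> to the boundary point in direction
    \<open>e t\<close>.\<close>
  define R where "R = B + norm c"
  have R: "norm z \<le> R" if "g z \<le> 1" for z
    using B[of "c + z"] that mem norm_triangle_ineq4[of "c + z" c] by (simp add: R_def)
  have M: "0 \<le> M" using supp[of 0] norm_ge_zero order_trans by blast
  have g_lip: "\<bar>g z - g w\<bar> \<le> M * norm (z - w)" for z w
  proof -
    have "g z - g w \<le> M * norm (z - w)" for z w
    proof -
      obtain v where v: "norm v \<le> M" "v \<bullet> z = g z" "v \<bullet> w \<le> g w" using supp[of z] by blast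
      then have "g z - g w \<le> v \<bullet> (z - w)" by (simp add: inner_diff_right)
      also have "\<dots> \<le> norm v * norm (z - w)" by (rule norm_cauchy_schwarz)
      also have "\<dots> \<le> M * norm (z - w)" using v by (intro mult_right_mono) auto
      finally show ?thesis .
    qed
    from this[of z w] this[of w z] show ?thesis by (simp add: norm_minus_commute abs_le_iff)
  qed
  then have g_cont: "continuous_on UNIV g"
    using M by (intro lipschitz_on_continuous_on[of M] lipschitz_onI) (auto simp: dist_norm)

  \<comment> \<open>\<open>e'\<close> is the derivative of \<open>e\<close>, and the clockwise
    orientation gives \<open>?J (e' t) = e t\<close>: the complex structure turns tangents
    outward.\<close>
  define e e' where "e t = (sin t, cos t)" and "e' t = (cos t, - sin t)" for t :: real
  define h where "h t = g (e t)" for t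
  define x where "x t = c + (1 / h t) *\<^sub>R e t" for t
  define \<gamma> where "\<gamma> t = (x t, ?J (x t))" for t
  have norm_e: "norm (e t) = 1" for t by (simp add: e_def norm_prod_def)
  have h: "0 < h t" for t unfolding h_def using norm_e[of t] by (intro pos) auto
  have g1: "g ((1 / h t) *\<^sub>R e t) = 1" for t using h[of t] by (simp add: hom) (simp add: h_def)
  then have hR: "1 / h t \<le> R" for t
    using R[of "(1 / h t) *\<^sub>R e t"] norm_e[of t] h[of t] by simp
  have "0 \<le> R" using hR[of 0] h[of 0] by (meson divide_nonneg_pos order_trans zero_le_one)
  have x_K: "x t \<in> K" for t using mem g1 by (simp add: x_def)
  have x_int: "x t \<notin> interior K" for t
  proof
    assume "x t \<in> interior K"
    then obtain r where r: "0 < r" "cball (x t) r \<subseteq> K" by (auto simp: mem_interior_cball)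
    \<comment> \<open>From an interior point one could still move outward along \<open>e t\<close>,
      where the gauge exceeds 1.\<close>
    have "c + (1 / h t + r) *\<^sub>R e t \<in> K"
      using r norm_e[of t] by (intro subsetD[OF r(2)]) (simp add: x_def dist_norm algebra_simps)
    then have "(1 / h t + r) * h t \<le> 1"
      using r(1) h[of t] by (simp add: mem hom flip: h_def)
    then show False using r(1) h[of t] mult_pos_pos[OF r(1) h[of t]] by (simp add: algebra_simps)
  qed

  have h_lip: "\<bar>h s - h t\<bar> \<le> 2 * M * \<bar>s - t\<bar>" for s t
    using g_lip[of "e s" "e t"] mult_left_mono[OF circle_difference(1)[of s t] M]
    by (simp add: h_def e_def)
  \<comment> \<open>In the bracket, \<open>2 * R\<close> comes from the turning of \<open>e\<close>
    and the other term from the variation of \<open>1 / h\<close>; the outer factor 2 counts the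
    components \<open>x\<close> and \<open>?J x\<close>.\<close>
  define L where "L = 2 * (2 * R + 2 * M * R\<^sup>2)"
  have x_lip: "norm (x s - x t) \<le> (2 * R + 2 * M * R\<^sup>2) * \<bar>s - t\<bar>" for s t
  proof -
    have "x s - x t = (1 / h s) *\<^sub>R (e s - e t) + (1 / h s - 1 / h t) *\<^sub>R e t"
      by (simp add: x_def algebra_simps)
    then have "norm (x s - x t) \<le> (1 / h s) * norm (e s - e t) + \<bar>1 / h s - 1 / h t\<bar>"
      using norm_triangle_ineq[of "(1 / h s) *\<^sub>R (e s - e t)" "(1 / h s - 1 / h t) *\<^sub>R e t"] h[of s] norm_e[of t]
      by simp
    also have "\<bar>1 / h s - 1 / h t\<bar> = (1 / h s) * (1 / h t) * \<bar>h s - h t\<bar>"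
    proof -
      have "1 / h s - 1 / h t = (1 / h s) * (1 / h t) * (h t - h s)"
        using h[of s] h[of t] by (simp add: field_simps)
      then show ?thesis using h[of s] h[of t] by (simp add: abs_mult abs_minus_commute)
    qed
    also have "(1 / h s) * norm (e s - e t) \<le> R * (2 * \<bar>s - t\<bar>)"
      using circle_difference(1)[of s t] hR[of s] \<open>0 \<le> R\<close> by (intro mult_mono) (auto simp: e_def)
    also have "(1 / h s) * (1 / h t) * \<bar>h s - h t\<bar> \<le> R * R * (2 * M * \<bar>s - t\<bar>)"
      using hR h h_lip \<open>0 \<le> R\<close> less_imp_le[OF h] by (intro mult_mono) auto
    finally show ?thesis by (simp add: power2_eq_square algebra_simps)
  qed
  have \<gamma>_lip: "norm (\<gamma> s - \<gamma> t) \<le> L * \<bar>s - t\<bar>" for s t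
  proof -
    interpret J: bounded_linear "?J :: real \<times> real \<Rightarrow> _" by (rule bounded_linear_complex_structure)
    have "norm (\<gamma> s - \<gamma> t) = norm (x s - x t, ?J (x s - x t))" by (simp add: \<gamma>_def J.diff)
    also have "\<dots> \<le> norm (x s - x t) + norm (?J (x s - x t))" by (rule norm_Pair_le)
    also have "\<dots> \<le> L * \<bar>s - t\<bar>" using x_lip[of s t] by (simp add: norm_complex_structure L_def algebra_simps)
    finally show ?thesis .
  qed

  \<comment> \<open>\<open>u t\<close> is a subgradient of \<open>g\<close> at \<open>e t\<close>,
    chosen with no regularity in \<open>t\<close>. It is an outer normal of \<open>K\<close> at
    \<open>x t\<close>.\<close>
  obtain u where u: "\<And>t. norm (u t) \<le> M" "\<And>t. u t \<bullet> e t = h t" "\<And>t w. u t \<bullet> w \<le> g w"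
    using supp[of "e t" for t] unfolding h_def by metis
  \<comment> \<open>\<open>h\<close> need not be convex, but a quadratic term compensates the curvature of the circle.\<close>
  define N where "N = {t. \<not> ((\<lambda>t. h t + M * t\<^sup>2) has_real_derivative u t \<bullet> e' t + 2 * M * t) (at t)}"
  have "countable N"
    unfolding N_def
  proof (rule subgradient_imp_differentiable)
    \<comment> \<open>Here \<open>h s\<close> is at least \<open>u t \<bullet> e s\<close>, and
      replacing \<open>e s\<close> by its tangent at \<open>t\<close> costs at most
      \<open>M * (s - t)\<^sup>2\<close>, which is exactly the convexity gap of
      \<open>M * t\<^sup>2\<close>.\<close>
    fix s t
    have "- (M * (s - t)\<^sup>2) \<le> u t \<bullet> (e s - e t - (s - t) *\<^sub>R e' t)"
    proof -
      have "\<bar>u t \<bullet> (e s - e t - (s - t) *\<^sub>R e' t)\<bar> \<le> norm (u t) * norm (e s - e t - (s - t) *\<^sub>R e' t)"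
        by (rule Cauchy_Schwarz_ineq2)
      also have "\<dots> \<le> M * (s - t)\<^sup>2"
        using circle_difference(2)[of s t] u(1)[of t] M by (intro mult_mono) (auto simp: e_def e'_def)
      finally show ?thesis by linarith
    qed
    then show "h t + M * t\<^sup>2 + (u t \<bullet> e' t + 2 * M * t) * (s - t) \<le> h s + M * s\<^sup>2"
      using u(2)[of t] u(3)[of t "e s"]
      by (simp add: h_def[of s] inner_diff_right algebra_simps power2_eq_square)
  qed
  then have N: "negligible N"
    by (simp add: negligible_iff_null_sets null_sets_completionI countable_imp_null_set_lborel)

  \<comment> \<open>The quotient rule for \<open>e / h\<close>, with
    \<open>u t \<bullet> e' t\<close> as the derivative of \<open>h\<close>.\<close>
  define G where "G t = (1 / h t) *\<^sub>R e' t - (u t \<bullet> e' t / (h t)\<^sup>2) *\<^sub>R e t" for t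
  have JG: "?J (G t) = (1 / (h t)\<^sup>2) *\<^sub>R u t" for t
  proof -
    \<comment> \<open>In the orthonormal frame \<open>e t\<close>, \<open>e' t\<close> the complex
      structure sends \<open>e'\<close> to \<open>e\<close> and \<open>e\<close> to
      \<open>- e'\<close>, so the coordinates of \<open>?J (G t)\<close> can be compared with those
      of \<open>u t\<close>.\<close>
    have "u t = (u t \<bullet> e t) *\<^sub>R e t + (u t \<bullet> e' t) *\<^sub>R e' t"
    proof (rule prod_eqI)
      let ?v = "(u t \<bullet> e t) *\<^sub>R e t + (u t \<bullet> e' t) *\<^sub>R e' t"
      have "fst ?v = fst (u t) * ((sin t)\<^sup>2 + (cos t)\<^sup>2)" "snd ?v = snd (u t) * ((sin t)\<^sup>2 + (cos t)\<^sup>2)"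
        by (simp_all add: e_def e'_def inner_prod_def algebra_simps power2_eq_square
            del: sin_cos_squared_add3)
      then show "fst (u t) = fst ?v" "snd (u t) = snd ?v" by simp_all
    qed
    then have "(1 / (h t)\<^sup>2) *\<^sub>R u t = (1 / (h t)\<^sup>2) *\<^sub>R (h t *\<^sub>R e t + (u t \<bullet> e' t) *\<^sub>R e' t)"
      using u(2) by simp
    also have "\<dots> = ?J (G t)"
      using h[of t]
      by (simp add: G_def e_def e'_def complex_structure_def algebra_simps power2_eq_square)
    finally show ?thesis by simp
  qed
  have \<gamma>_deriv: "(\<gamma> has_vector_derivative (G t, ?J (G t))) (at t)" if "t \<notin> N" for t
  proof -
    have "((\<lambda>t. h t + M * t\<^sup>2 - M * t\<^sup>2) has_real_derivative (u t \<bullet> e' t + 2 * M * t) - 2 * M * t) (at t)"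
      using that unfolding N_def by (intro DERIV_diff) (auto intro!: derivative_eq_intros)
    then have dh: "(h has_real_derivative u t \<bullet> e' t) (at t)" by simp
    have de: "(e has_vector_derivative e' t) (at t)"
      unfolding e_def e'_def
      by (intro has_vector_derivative_Pair) (auto intro!: derivative_eq_intros
          simp flip: has_real_derivative_iff_has_vector_derivative)
    have "((\<lambda>t. 1 / h t) has_real_derivative - (u t \<bullet> e' t / (h t)\<^sup>2)) (at t)"
      using dh h[of t] by (auto intro!: derivative_eq_intros simp: power2_eq_square)
    from has_vector_derivative_add[OF has_vector_derivative_const has_vector_derivative_scaleR[OF this de]]
    have dx: "(x has_vector_derivative G t) (at t)"
      unfolding x_def[abs_def] G_def by simp
    then show ?thesis
      unfolding \<gamma>_def
      by (intro has_vector_derivative_Pair bounded_linear.has_vector_derivative[OF bounded_linear_complex_structure])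
  qed
  let ?T = "2 * pi"
  have vel: "velocity ?T \<gamma> t = (G t, ?J (G t))" if "t \<in> {0..?T} - N" for t
    using that by (intro vector_derivative_at_within_ivl \<gamma>_deriv) auto
  have per: "\<gamma> (t + ?T) = \<gamma> t" for t by (simp add: \<gamma>_def x_def h_def e_def)
  have \<gamma>_vel: "(\<gamma> has_vector_derivative velocity ?T \<gamma> t) (at t)" if "t \<in> {0..?T} - N" for t
    using vel[OF that] \<gamma>_deriv that by simp
  note derivative = periodic_Lipschitz_derivative[where f=\<gamma>, OF _ \<gamma>_lip per N \<gamma>_vel, simplified]

  \<comment> \<open>\<open>A\<close> collects the contribution of the centre \<open>c\<close> to the
    action; being linear in the velocity of a closed curve, it integrates to 0.\<close>
  define A where "A v = symplectic_form (c, ?J c) v" for v :: "(real \<times> real) \<times> real \<times> real"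
  have A: "bounded_linear A"
    unfolding A_def symplectic_form_def by (intro bounded_linear_intros)
  \<comment> \<open>The rest of the density is twice the inner product of \<open>e / h\<close> with
    \<open>u / h\<^sup>2\<close>, and \<open>u \<bullet> e = h\<close>.\<close>
  have sympl: "A (velocity ?T \<gamma> t) + 2 / (h t)\<^sup>2 = symplectic_form (\<gamma> t) (velocity ?T \<gamma> t)"
    if "t \<in> {0..?T} - N" for t
  proof -
    have *: "symplectic_form (z, ?J z) (G t, ?J (G t)) = 2 * (z \<bullet> ?J (G t))" for z
      by (simp add: symplectic_form_def complex_structure_def inner_prod_def)
    show ?thesis
      unfolding A_def vel[OF that] unfolding \<gamma>_def *
      using h[of t] u(2)[of t]
      by (simp add: JG x_def inner_commute[of _ "u t"] inner_add_right power2_eq_square add_divide_distrib)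
  qed
  have S: "measure lborel {z. g z \<le> 1} = measure lebesgue K"
  proof -
    have "K = (+) c ` {z. g z \<le> 1}"
    proof (intro equalityI subsetI)
      fix y assume "y \<in> K"
      then have "g (y - c) \<le> 1" using mem[of "y - c"] by simp
      then show "y \<in> (+) c ` {z. g z \<le> 1}" by (intro image_eqI[of _ _ "y - c"]) auto
    qed (use mem in auto)
    then have "measure lebesgue K = measure lebesgue {z. g z \<le> 1}" by (simp add: measure_translation)
    moreover have "closed {z. g z \<le> 1}"
      by (intro closed_Collect_le g_cont continuous_intros)
    ultimately show ?thesis by simp
  qed
  \<comment> \<open>The polar formula gives twice the area for \<open>1 / h\<^sup>2\<close>, hence
    four times here; the factor 1/2 in \<open>action\<close> halves this.\<close>
  have area: "((\<lambda>t. 2 / (h t)\<^sup>2) has_integral 4 * measure lebesgue K) {0..?T}"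
    using has_integral_mult_right[OF has_integral_polar_area[OF hom pos g_cont], of 2]
    by (simp add: S h_def e_def)
  have "(\<lambda>t. 2 / (h t)\<^sup>2) absolutely_integrable_on {0..?T}"
    using area by (intro nonnegative_absolutely_integrable_1) (auto simp: has_integral_integrable)
  moreover have "(\<lambda>t. A (velocity ?T \<gamma> t)) absolutely_integrable_on {0..?T}"
    using integrable_bounded_linear[OF A derivative(1)]
    by (simp add: integrable_restrict_space set_integrable_def)
  ultimately have "(\<lambda>t. A (velocity ?T \<gamma> t) + 2 / (h t)\<^sup>2) absolutely_integrable_on {0..?T}"
    by (intro set_integral_add)
  then have "(\<lambda>t. symplectic_form (\<gamma> t) (velocity ?T \<gamma> t)) absolutely_integrable_on {0..?T}"
    by (rule absolutely_integrable_spike[OF _ N]) (simp add: sympl)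
  then have int: "integrable (lebesgue_on {0..?T}) (\<lambda>t. symplectic_form (\<gamma> t) (velocity ?T \<gamma> t))"
    by (simp add: integrable_restrict_space set_integrable_def)
  have "((\<lambda>t. A (velocity ?T \<gamma> t)) has_integral 0) {0..?T}"
    using has_integral_linear[OF derivative(2) A] bounded_linear.linear[OF A]
    by (simp add: o_def linear_0)
  then have "((\<lambda>t. A (velocity ?T \<gamma> t) + 2 / (h t)\<^sup>2) has_integral 4 * measure lebesgue K) {0..?T}"
    using has_integral_add[OF _ area] by fastforce
  then have "((\<lambda>t. symplectic_form (\<gamma> t) (velocity ?T \<gamma> t)) has_integral 4 * measure lebesgue K) {0..?T}"
    by (rule has_integral_spike[OF N, rotated]) (simp add: sympl)
  then have "action ?T \<gamma> = 2 * measure lebesgue K"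
    unfolding action_def using lebesgue_integral_eq_integral[OF int] by (simp add: integral_unique)
  moreover have "closed_characteristic ?C ?T \<gamma>"
    unfolding closed_characteristic_def
  proof (intro conjI)
    show "\<gamma> ` {0..?T} \<subseteq> frontier ?C"
      using x_K x_int by (auto simp: \<gamma>_def intro!: frontier_lagrangian_product)
    show "\<gamma> 0 = \<gamma> ?T" using per[of 0] by simp
    show "\<not> \<gamma> constant_on {0..?T}"
    proof
      assume "\<gamma> constant_on {0..?T}"
      \<comment> \<open>The angles 0 and \<open>pi\<close> give points on opposite sides of
        \<open>c\<close>.\<close>
      then have "\<gamma> 0 = \<gamma> pi" by (fastforce simp: constant_on_def)
      then have "1 / h 0 = - (1 / h pi)" by (simp add: \<gamma>_def x_def e_def)
      then show False using h[of 0] h[of pi]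
        by (metis less_asym neg_less_0_iff_less zero_less_divide_1_iff)
    qed
    show "abs_continuous_curve 0 ?T \<gamma>"
      by (rule Lipschitz_imp_abs_continuous_curve) (use \<gamma>_lip in \<open>simp add: dist_norm\<close>)
    show "integrable (lebesgue_on {0..?T}) (\<lambda>t. (norm (velocity ?T \<gamma> t))\<^sup>2)"
    proof (rule finite_measure.integrable_const_bound[OF finite_measure_lebesgue_on])
      show "AE t in lebesgue_on {0..?T}. norm ((norm (velocity ?T \<gamma> t))\<^sup>2) \<le> L\<^sup>2"
        by (rule AE_lebesgue_on_Diff[OF N]) (use derivative(3) in \<open>auto intro!: power_mono\<close>)
      show "(\<lambda>t. (norm (velocity ?T \<gamma> t))\<^sup>2) \<in> borel_measurable (lebesgue_on {0..?T})"
        using borel_measurable_integrable[OF derivative(1)] by measurable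
    qed simp
    show "AE t in lebesgue_on {0..?T}. \<gamma> differentiable (at t within {0..?T}) \<and>
        velocity ?T \<gamma> t \<in> ?J ` normal_cone ?C (\<gamma> t)"
    proof (rule AE_lebesgue_on_Diff[OF N], simp, rule conjI)
      fix t assume t: "t \<in> {0..?T} - N"
      then show "\<gamma> differentiable (at t within {0..?T})"
        using \<gamma>_deriv[of t] by (metis DiffD2 differentiableI_vector differentiable_at_withinI)
      \<comment> \<open>This is the preimage of the velocity under the complex structure of the
        product space. Both components of its pairing with \<open>z - \<gamma> t\<close> reduce to
        the support inequality for \<open>u t\<close> at \<open>x t\<close>, the second because
        \<open>?J\<close> preserves inner products and squares to minus the identity.\<close>
      have "(?J (G t), - G t) \<in> normal_cone ?C (\<gamma> t)"
        unfolding normal_cone_def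
      proof (intro CollectI ballI)
        have *: "u t \<bullet> (y - x t) \<le> 0" if "y \<in> K" for y
        proof -
          have "u t \<bullet> (y - c) \<le> g (y - c)" by (rule u(3))
          also have "\<dots> \<le> 1" using mem[of "y - c"] that by simp
          also have "1 = u t \<bullet> (x t - c)" using u(2)[of t] h[of t] by (simp add: x_def)
          finally show ?thesis by (simp add: inner_diff_right)
        qed
        fix z assume "z \<in> ?C"
        then obtain y w where z: "z = (y, ?J w)" "y \<in> K" "w \<in> K" by (auto simp: lagrangian_product_def)
        have "- G t \<bullet> (?J w - ?J (x t)) = ?J (G t) \<bullet> (w - x t)"
          by (simp add: complex_structure_def inner_prod_def algebra_simps)
        then have "(?J (G t), - G t) \<bullet> (z - \<gamma> t) = (u t \<bullet> (y - x t) + u t \<bullet> (w - x t)) / (h t)\<^sup>2"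
          by (simp add: z \<gamma>_def JG add_divide_distrib)
        also have "\<dots> \<le> 0" using *[OF z(2)] *[OF z(3)] by (intro divide_nonpos_nonneg) auto
        finally show "(?J (G t), - G t) \<bullet> (z - \<gamma> t) \<le> 0" .
      qed
      moreover have "velocity ?T \<gamma> t = ?J (?J (G t), - G t)"
        using vel[OF t] by (simp add: complex_structure_def[of "(_, _)"])
      ultimately show "velocity ?T \<gamma> t \<in> ?J ` normal_cone ?C (\<gamma> t)" by blast
    qed
  qed simp
  ultimately show ?thesis
    unfolding c_EHZ_def by (intro Inf_lower) (auto intro!: exI[of _ ?T] exI[of _ \<gamma>])
qed

end
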